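(* For every integer $n\ge 3$ there exists a Heffter array $H(5,n)$. If moreover $n\equiv 0,3\pmod 4$, then the array can be taken to be an integer Heffter array.
   Context: A (tight) Heffter array $H(m,n)$ is an $m\times n$ array with every cell filled by an element of $\mathbb{Z}_{2mn+1}$ such that every row and every column sums to $0$ modulo $2mn+1$, and no element of any pair $\{x,-x\}$ appears twice (using representatives $-mn,\dots,mn$, entries are nonzero and each of $1,\dots,mn$ appears exactly once up to sign). An integer Heffter array $H(m,n)$ is an $m\times n$ array with entries from $\{-mn,\dots,mn\}$ such that every row and column sums to $0$ over the integers and no element from any $\{x,-x\}$ appears twice, so the multiset of absolute values of entries is $\{1,\dots,mn\}$. *)

theory Defs
  imports Main "HOL-Number_Theory.Cong"
begin

text \<open>
  An \<open>m \<times> n\<close> array is a function \<open>A :: nat \<Rightarrow> nat \<Rightarrow> int\<close>, of which only the values \<open>A i j\<close> with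
  \<open>i < m\<close> and \<open>j < n\<close> matter. An element of \<open>\<int>/(2mn+1)\<close> is given by its unique representative
  in \<open>{-mn..mn}\<close>; negation modulo \<open>2mn+1\<close> is then integer negation, so the condition on entries is
  the same in the modular and in the integer setting. The entry 0 is excluded explicitly, since
  the pair \<open>{x, -x}\<close> degenerates for \<open>x = 0\<close>.
\<close>

definition heffter_entries :: "nat \<Rightarrow> nat \<Rightarrow> (nat \<Rightarrow> nat \<Rightarrow> int) \<Rightarrow> bool" where
  "heffter_entries m n A \<longleftrightarrow>
     (\<forall>i<m. \<forall>j<n. A i j \<in> {- int (m * n)..int (m * n)} \<and> A i j \<noteq> 0) \<and>
     (\<forall>i<m. \<forall>j<n. \<forall>i'<m. \<forall>j'<n.
        (i, j) \<noteq> (i', j') \<longrightarrow> A i j \<noteq> A i' j' \<and> A i j \<noteq> - A i' j')"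

definition heffter_array :: "nat \<Rightarrow> nat \<Rightarrow> (nat \<Rightarrow> nat \<Rightarrow> int) \<Rightarrow> bool" where
  "heffter_array m n A \<longleftrightarrow>
     heffter_entries m n A \<and>
     (\<forall>i<m. [(\<Sum>j<n. A i j) = 0] (mod (2 * int m * int n + 1))) \<and>
     (\<forall>j<n. [(\<Sum>i<m. A i j) = 0] (mod (2 * int m * int n + 1)))"

definition integer_heffter_array :: "nat \<Rightarrow> nat \<Rightarrow> (nat \<Rightarrow> nat \<Rightarrow> int) \<Rightarrow> bool" where
  "integer_heffter_array m n A \<longleftrightarrow>
     heffter_entries m n A \<and>
     (\<forall>i<m. (\<Sum>j<n. A i j) = 0) \<and>
     (\<forall>j<n. (\<Sum>i<m. A i j) = 0)"

lemma integer_heffter_array_imp_heffter_array: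
  "integer_heffter_array m n A \<Longrightarrow> heffter_array m n A"
  by (simp add: integer_heffter_array_def heffter_array_def)

lemma heffter_entries_iff_bij_betw:
  "heffter_entries m n A \<longleftrightarrow>
     bij_betw (\<lambda>(i, j). \<bar>A i j\<bar>) ({..<m} \<times> {..<n}) {1..int (m * n)}"
  (is "_ \<longleftrightarrow> bij_betw ?f ?C ?T")
proof
  assume H: "heffter_entries m n A"
  have inj: "inj_on ?f ?C"
    unfolding inj_on_def using H
    unfolding heffter_entries_def by (clarsimp simp: abs_eq_iff) blast
  have sub: "?f ` ?C \<subseteq> ?T"
  proof (rule image_subsetI)
    fix p assume "p \<in> ?C"
    then obtain i j where p: "p = (i, j)" "i < m" "j < n" by auto
    then have "A i j \<in> {- int (m * n)..int (m * n)}" "A i j \<noteq> 0"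
      using H unfolding heffter_entries_def by auto
    then show "?f p \<in> ?T" unfolding p(1) prod.case atLeastAtMost_iff by linarith
  qed
  have "card (?f ` ?C) = card ?T"
    using card_image[OF inj] by (simp del: of_nat_mult)
  with sub have "?f ` ?C = ?T"
    by (intro card_subset_eq) auto
  with inj show "bij_betw ?f ?C ?T"
    by (simp add: bij_betw_def)
next
  assume B: "bij_betw ?f ?C ?T"
  have r: "A i j \<in> {- int (m * n)..int (m * n)} \<and> A i j \<noteq> 0" if "i < m" "j < n" for i j
  proof -
    have "?f (i, j) \<in> ?T"
      using bij_betw_imp_surj_on[OF B] that by fast
    then show ?thesis unfolding atLeastAtMost_iff prod.case by linarith
  qed
  have d: "A i j \<noteq> A i' j' \<and> A i j \<noteq> - A i' j'"
    if "i < m" "j < n" "i' < m" "j' < n" "(i, j) \<noteq> (i', j')" for i j i' j'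
  proof -
    have "?f (i, j) \<noteq> ?f (i', j')"
      using inj_on_eq_iff[OF bij_betw_imp_inj_on[OF B], of "(i, j)" "(i', j')"] that by simp
    then show ?thesis by auto
  qed
  show "heffter_entries m n A"
    unfolding heffter_entries_def using r d by blast
qed

end

theory Submission imports Defs begin

text \<open>
  Start from a Heffter array \<open>H(5,r)\<close> with \<open>r \<in> {3,4,5,6}\<close> and cut the number line \<open>1..5r\<close> at a few
  places, inserting there intervals whose lengths are multiples of \<open>k\<close> and add up to \<open>20k\<close>. The old
  entries turn into \<open>a k + b\<close>; the inserted intervals are divided into 20 arithmetic progressions
  \<open>a k + b + s t\<close> (\<open>t < k\<close>), arranged as \<open>k\<close> blocks of size \<open>5 \<times> 4\<close>. If the columns of the block
  vanish identically in \<open>k\<close> and \<open>t\<close>, and each of its rows has a sum not depending on \<open>k\<close> or \<open>t\<close>,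
  which the old entries compensate, the result is an \<open>H(5, r + 4k)\<close>. All conditions are finitely
  many linear identities between the coefficients, so one table for each \<open>r\<close> settles all \<open>n \<ge> 3\<close>. The
  tables were found by computer search.
\<close>

section \<open>Templates and tilings of the number line\<close>

text \<open>
  A pair \<open>(a, b)\<close> in \<open>E\<close> stands for the number \<open>a k + b\<close>, a triple \<open>(a, b, s)\<close> in \<open>P\<close> for the
  progression \<open>a k + b + s t\<close>, \<open>t < k\<close>. The list says how absolute values are used from \<open>a k + b\<close>
  upwards: \<open>0\<close> is a single entry of \<open>E\<close>, and \<open>d > 0\<close> is an interval of length \<open>d k\<close> made up of \<open>d\<close>
  interleaved progressions of step \<open>d\<close>, each of them ascending or descending and of either sign.
\<close>

fun tiled ::
  "nat \<Rightarrow> nat \<Rightarrow> nat \<Rightarrow> (int \<times> int) list list \<Rightarrow> (int \<times> int \<times> int) list list \<Rightarrow>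
   nat list \<Rightarrow> int \<Rightarrow> int \<Rightarrow> bool" where
  "tiled m r w E P [] a b \<longleftrightarrow> a = int (m * w) \<and> b = int (m * r) + 1"
| "tiled m r w E P (d # ds) a b \<longleftrightarrow>
     (if d = 0
      then (\<exists>i<m. \<exists>j<r. E ! i ! j \<in> {(a, b), (- a, - b)}) \<and> tiled m r w E P ds a (b + 1)
      else (\<forall>f<d. \<exists>i<m. \<exists>c<w. P ! i ! c \<in>
              {(a, b + int f, int d), (a + int d, b + int f - int d, - int d),
               (- a, - (b + int f), - int d), (- (a + int d), - (b + int f - int d), int d)})
           \<and> tiled m r w E P ds (a + int d) b)"

text \<open>
  The modulus for \<open>n = r + w k\<close> is \<open>2mw k + (2mr + 1)\<close>; \<open>\<rho>\<close> and \<open>\<kappa>\<close> list the multiples of it to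
  which the rows and the first \<open>r\<close> columns sum.
\<close>

definition template ::
  "nat \<Rightarrow> nat \<Rightarrow> nat \<Rightarrow> (int \<times> int) list list \<Rightarrow> (int \<times> int \<times> int) list list \<Rightarrow>
   int list \<Rightarrow> int list \<Rightarrow> nat list \<Rightarrow> bool" where
  "template m r w E P \<rho> \<kappa> ds \<longleftrightarrow>
     (\<forall>i<m. (\<Sum>c<w. fst (P ! i ! c)) = 0 \<and> (\<Sum>c<w. snd (snd (P ! i ! c))) = 0 \<and>
        (\<Sum>j<r. fst (E ! i ! j)) + (\<Sum>c<w. fst (snd (P ! i ! c))) = \<rho> ! i * (2 * int m * int w) \<and>
        (\<Sum>j<r. snd (E ! i ! j)) = \<rho> ! i * (2 * int m * int r + 1)) \<and>
     (\<forall>j<r. (\<Sum>i<m. fst (E ! i ! j)) = \<kappa> ! j * (2 * int m * int w) \<and>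
        (\<Sum>i<m. snd (E ! i ! j)) = \<kappa> ! j * (2 * int m * int r + 1)) \<and>
     (\<forall>c<w. (\<Sum>i<m. fst (P ! i ! c)) = 0 \<and> (\<Sum>i<m. fst (snd (P ! i ! c))) = 0 \<and>
        (\<Sum>i<m. snd (snd (P ! i ! c))) = 0) \<and>
     tiled m r w E P ds 0 1"

section \<open>Expansion of a template into an array\<close>

definition expand ::
  "nat \<Rightarrow> nat \<Rightarrow> (int \<times> int) list list \<Rightarrow> (int \<times> int \<times> int) list list \<Rightarrow> nat \<Rightarrow>
   nat \<Rightarrow> nat \<Rightarrow> int" where
  "expand r w E P k i j =
     (if j < r then fst (E ! i ! j) * int k + snd (E ! i ! j)
      else let (a, b, s) = P ! i ! ((j - r) mod w) in a * int k + b + s * int ((j - r) div w))"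

lemma expand_base: "j < r \<Longrightarrow> expand r w E P k i j = fst (E ! i ! j) * int k + snd (E ! i ! j)"
  by (simp add: expand_def)

lemma expand_prog:
  "c < w \<Longrightarrow> expand r w E P k i (r + (w * t + c)) =
     fst (P ! i ! c) * int k + fst (snd (P ! i ! c)) + snd (snd (P ! i ! c)) * int t"
  by (simp add: expand_def case_prod_beta)

lemma block_index_less:
  fixes t k c w :: nat
  assumes "t < k" "c < w"
  shows "w * t + c < w * k"
proof -
  have "w * t + c < w * Suc t" using assms by simp
  also have "\<dots> \<le> w * k" using assms by (intro mult_le_mono2) simp
  finally show ?thesis .
qed

lemma sum_split_blocks:
  fixes f :: "nat \<Rightarrow> int"
  shows "(\<Sum>j<r + w * k. f j) = (\<Sum>j<r. f j) + (\<Sum>t<k. \<Sum>c<w. f (r + (w * t + c)))"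
proof (induction k)
  case (Suc k)
  have "(\<Sum>j<a + w. f j) = (\<Sum>j<a. f j) + (\<Sum>c<w. f (a + c))" for a
    by (induction w) simp_all
  from this[of "r + w * k"] Suc show ?case by (simp add: ac_simps)
qed simp

text \<open>Induction along the tiling: \<open>a * k + b\<close> is the least absolute value that
  the remaining list still has to supply. When the list ends, this value is already one more than
  the number of cells.\<close>

lemma tiled_covers:
  assumes "tiled m r w E P ds a b" and "a * int k + b \<le> x" and "x \<le> int (m * (r + w * k))"
    and "0 \<le> x"
  shows "\<exists>i<m. \<exists>j<r + w * k. \<bar>expand r w E P k i j\<bar> = x"
  using assms(1,2)
proof (induction ds arbitrary: a b)
  case Nil
  then show ?case using assms(3) by (simp add: algebra_simps)
next
  case (Cons d ds)
  show ?case
  proof (cases "d = 0")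
    case True
    show ?thesis
    proof (cases "x = a * int k + b")
      case x: True
      obtain i j where ij: "i < m" "j < r" "E ! i ! j \<in> {(a, b), (- a, - b)}"
        using Cons.prems(1) True by auto
      then have "\<bar>expand r w E P k i j\<bar> = x"
        using x assms(4) by (auto simp: expand_base)
      then show ?thesis using ij(1) trans_less_add1[OF ij(2)] by blast
    next
      case False
      with True Cons.prems Cons.IH[of a "b + 1"] show ?thesis by simp
    qed
  next
    case False
    show ?thesis
    proof (cases "x < (a + int d) * int k + b")
      case less: True
      define y where "y = nat (x - (a * int k + b))"
      have y: "x = a * int k + b + int y" using Cons.prems(2) by (simp add: y_def)
      have "int y < int (k * d)" using less y by (simp add: algebra_simps)
      then have t: "y div d < k" unfolding of_nat_less_iff by (rule less_mult_imp_div_less)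
      have f: "y mod d < d" using False by simp
      have yd: "int y = int d * int (y div d) + int (y mod d)"
        by (metis mult_div_mod_eq of_nat_add of_nat_mult)
      \<comment> \<open>At offset \<open>y\<close> into the interval, \<open>y mod d\<close> selects
        the progression and \<open>y div d\<close> the term. A descending progression starts at its
        largest value and so reaches \<open>x\<close> at the mirrored index
        \<open>u\<close>.\<close>
      define u where "u = k - 1 - y div d"
      have u: "int u = int k - 1 - int (y div d)" "u < k" using t by (simp_all add: u_def)
      obtain i c where ic: "i < m" "c < w" "P ! i ! c \<in>
              {(a, b + int (y mod d), int d), (a + int d, b + int (y mod d) - int d, - int d),
               (- a, - (b + int (y mod d)), - int d),
               (- (a + int d), - (b + int (y mod d) - int d), int d)}"
        using Cons.prems(1) False f by auto
      have "\<bar>expand r w E P k i (r + (w * (y div d) + c))\<bar> = x \<or>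
            \<bar>expand r w E P k i (r + (w * u + c))\<bar> = x"
      proof -
        have "expand r w E P k i (r + (w * (y div d) + c)) \<in> {x, - x} \<or>
              expand r w E P k i (r + (w * u + c)) \<in> {x, - x}"
          using ic(3) unfolding expand_prog[OF ic(2)] y yd
          by (auto simp: u(1) algebra_simps)
        then show ?thesis using assms(4) by auto
      qed
      moreover have "r + (w * (y div d) + c) < r + w * k" "r + (w * u + c) < r + w * k"
        using block_index_less[OF t ic(2)] block_index_less[OF u(2) ic(2)] by simp_all
      ultimately show ?thesis using ic(1) by blast
    next
      case ge: False
      with False Cons.prems Cons.IH[of "a + int d" b] show ?thesis by simp
    qed
  qed
qed

text \<open>Pigeonhole: there are as many cells as values to attain, so attaining them all leaves no
  room for a repetition or for a value out of range.\<close>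

lemma heffter_entries_if_surj:
  assumes "\<And>x. 1 \<le> x \<Longrightarrow> x \<le> int (m * n) \<Longrightarrow> \<exists>i<m. \<exists>j<n. \<bar>A i j\<bar> = x"
  shows "heffter_entries m n A"
proof -
  let ?f = "\<lambda>(i, j). \<bar>A i j\<bar>" and ?C = "{..<m} \<times> {..<n}" and ?T = "{1..int (m * n)}"
  have sub: "?T \<subseteq> ?f ` ?C"
  proof
    fix x assume "x \<in> ?T"
    then obtain i j where "i < m" "j < n" "\<bar>A i j\<bar> = x" using assms[of x] by auto
    then show "x \<in> ?f ` ?C" by force
  qed
  have card: "card ?C = card ?T" by (simp del: of_nat_mult)
  have "?T = ?f ` ?C"
    using sub card_image_le[of ?C ?f] card by (intro card_seteq) auto
  moreover from this card have "inj_on ?f ?C"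
    by (intro eq_card_imp_inj_on) auto
  ultimately show ?thesis
    unfolding heffter_entries_iff_bij_betw bij_betw_def by simp
qed

section \<open>Row and column sums\<close>

text \<open>Each block adds the same constant to a row, so \<open>k\<close> blocks add to the
  coefficient of \<open>k\<close>, where the old entries compensate.\<close>

lemma expand_row_sum:
  assumes "template m r w E P \<rho> \<kappa> ds" "i < m"
  shows "(\<Sum>j<r + w * k. expand r w E P k i j) = \<rho> ! i * (2 * int m * int (r + w * k) + 1)"
proof -
  let ?p = "\<lambda>c. P ! i ! c"
  have t: "(\<Sum>c<w. fst (?p c)) = 0" "(\<Sum>c<w. snd (snd (?p c))) = 0"
      "(\<Sum>j<r. fst (E ! i ! j)) + (\<Sum>c<w. fst (snd (?p c))) = \<rho> ! i * (2 * int m * int w)"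
      "(\<Sum>j<r. snd (E ! i ! j)) = \<rho> ! i * (2 * int m * int r + 1)"
    using assms by (auto simp: template_def)
  have "(\<Sum>c<w. expand r w E P k i (r + (w * t + c))) = (\<Sum>c<w. fst (snd (?p c)))" for t
    using t(1,2) by (simp add: expand_prog sum.distrib flip: sum_distrib_right)
  then have "(\<Sum>j<r + w * k. expand r w E P k i j) =
      int k * ((\<Sum>j<r. fst (E ! i ! j)) + (\<Sum>c<w. fst (snd (?p c)))) + (\<Sum>j<r. snd (E ! i ! j))"
    unfolding sum_split_blocks
    by (simp add: expand_base sum.distrib sum_distrib_left algebra_simps)
  also have "\<dots> = \<rho> ! i * (2 * int m * int (r + w * k) + 1)"
    unfolding t(3,4) by (simp add: algebra_simps)
  finally show ?thesis .
qed

lemma expand_column_sum: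
  assumes "template m r w E P \<rho> \<kappa> ds" "j < r + w * k"
  shows "(\<Sum>i<m. expand r w E P k i j) =
    (if j < r then \<kappa> ! j * (2 * int m * int (r + w * k) + 1) else 0)"
proof (cases "j < r")
  case True
  then have "(\<Sum>i<m. fst (E ! i ! j)) = \<kappa> ! j * (2 * int m * int w)"
      "(\<Sum>i<m. snd (E ! i ! j)) = \<kappa> ! j * (2 * int m * int r + 1)"
    using assms(1) by (auto simp: template_def)
  with True show ?thesis
    by (simp add: expand_base sum.distrib flip: sum_distrib_right) (simp add: algebra_simps)
next
  case False
  define t c where "t = (j - r) div w" and "c = (j - r) mod w"
  have "w > 0" using False assms(2) by (cases w) auto
  then have c: "c < w" and j: "j = r + (w * t + c)" using False by (simp_all add: c_def t_def)
  have "(\<Sum>i<m. fst (P ! i ! c)) = 0" "(\<Sum>i<m. fst (snd (P ! i ! c))) = 0"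
      "(\<Sum>i<m. snd (snd (P ! i ! c))) = 0"
    using assms(1) c by (auto simp: template_def)
  then show ?thesis
    using False unfolding j expand_prog[OF c]
    by (simp add: sum.distrib flip: sum_distrib_right)
qed

lemma heffter_array_expand:
  assumes T: "template m r w E P \<rho> \<kappa> ds"
  shows "heffter_array m (r + w * k) (expand r w E P k)"
proof -
  have "tiled m r w E P ds 0 1" using T by (simp add: template_def)
  then have "heffter_entries m (r + w * k) (expand r w E P k)"
    by (intro heffter_entries_if_surj tiled_covers) auto
  then show ?thesis
    unfolding heffter_array_def
    by (auto simp: expand_row_sum[OF T] expand_column_sum[OF T] cong_0_iff simp del: of_nat_add)
qed

lemma integer_heffter_array_expand:
  assumes T: "template m r w E P (replicate m 0) (replicate r 0) ds"
  shows "integer_heffter_array m (r + w * k) (expand r w E P k)"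
  using heffter_array_expand[OF T, of k]
  by (auto simp: heffter_array_def integer_heffter_array_def expand_row_sum[OF T]
      expand_column_sum[OF T])

section \<open>Tables for the four residue classes modulo 4\<close>

definition base_3 :: "(int \<times> int) list list" where
  "base_3 =
   [[(4, 7), (0, -2), (-4, -5)],
    [(0, 1), (-11, -13), (11, 12)],
    [(11, 11), (-11, -8), (0, -3)],
    [(-11, -15), (11, 9), (4, 6)],
    [(-4, -4), (11, 14), (-11, -10)]]"

definition progs_3 :: "(int \<times> int \<times> int) list list" where
  "progs_3 =
   [[(8, 8, 1), (-18, -16, -1), (-6, -8, -2), (16, 16, 2)],
    [(-12, -15, 1), (13, 15, -1), (13, 16, 1), (-14, -16, -1)],
    [(2, 3, -2), (-4, -3, 2), (-6, -7, 2), (8, 7, -2)],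
    [(-2, -4, -2), (9, 8, 2), (-16, -17, -2), (9, 9, 2)],
    [(4, 8, 2), (0, -4, -2), (15, 16, 1), (-19, -16, -1)]]"

lemma template_3:
  "template 5 3 4 base_3 progs_3 (replicate 5 0) (replicate 3 0)
     (replicate 3 0 @ [2, 2] @ replicate 4 0 @ [2, 2, 1, 2] @ replicate 8 0 @ [1, 1, 1, 1, 1, 2, 1, 1])"
  by code_simp

definition base_4 :: "(int \<times> int) list list" where
  "base_4 =
   [[(-20, -12), (20, 13), (-16, -6), (16, 5)],
    [(20, 10), (-20, -9), (0, -2), (0, 1)],
    [(20, 20), (-20, -19), (16, 7), (-16, -8)],
    [(0, -3), (0, 4), (-20, -17), (20, 16)],
    [(-20, -15), (20, 11), (20, 18), (-20, -14)]]"

definition progs_4 :: "(int \<times> int \<times> int) list list" where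
  "progs_4 =
   [[(2, 5, 1), (-3, -6, -2), (13, 4, -1), (-12, -3, 2)],
    [(17, 9, 1), (-20, -8, 1), (-16, -9, -1), (19, 8, -1)],
    [(0, -6, -2), (5, 6, 2), (0, 5, 2), (-5, -5, -2)],
    [(-3, -5, -2), (9, 3, -2), (10, 6, 2), (-16, -4, 2)],
    [(-16, -3, 2), (9, 5, 1), (-7, -6, -2), (14, 4, -1)]]"

lemma template_4:
  "template 5 4 4 base_4 progs_4 (replicate 5 0) (replicate 4 0)
     (replicate 4 0 @ [2, 1, 2, 2, 2, 1, 2, 1, 1, 2] @ replicate 4 0 @ [1, 1, 1, 1] @ replicate 12 0)"
  by code_simp

definition base_5 :: "(int \<times> int) list list" where
  "base_5 =
   [[(20, 17), (20, 23), (0, 2), (-20, -9), (20, 18)],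
    [(20, 22), (6, 4), (-20, -20), (14, 7), (-20, -13)],
    [(0, 1), (-20, -24), (20, 25), (20, 14), (-20, -16)],
    [(-20, -10), (14, 8), (20, 12), (-20, -15), (6, 5)],
    [(20, 21), (-20, -11), (-20, -19), (6, 3), (14, 6)]]"

definition progs_5 :: "(int \<times> int \<times> int) list list" where
  "progs_5 =
   [[(0, 3, 1), (-2, -2, 1), (-9, -6, -1), (11, 5, -1)],
    [(17, 9, 1), (-18, -10, -2), (17, 8, -1), (-16, -7, 2)],
    [(6, 2, -2), (-4, -3, -2), (-4, -2, 2), (2, 3, 2)],
    [(-9, -4, 2), (6, 6, 1), (-11, -7, -2), (14, 5, -1)],
    [(-14, -10, -2), (18, 9, 2), (7, 7, 2), (-11, -6, -2)]]"

text \<open>For n \<equiv> 1, 2 modulo 4 the sum 1 + ... + 5n is odd, so the entries cannot add up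
  to 0 over the integers; here one row and one column sum to the modulus itself.\<close>

lemma template_5:
  "template 5 5 4 base_5 progs_5 [1, 0, 0, 0, 0] [1, 0, 0, 0, 0]
     (replicate 2 0 @ [1, 1, 2, 2] @ replicate 3 0 @ [1, 2, 1, 1, 2, 1] @ replicate 3 0 @ [2, 1, 1, 2] @ replicate 17 0)"
  by code_simp

definition base_6 :: "(int \<times> int) list list" where
  "base_6 =
   [[(-16, -20), (-20, -27), (-20, -26), (-4, -7), (4, 11), (4, 8)],
    [(-16, -21), (4, 10), (-4, -9), (-16, -15), (16, 19), (16, 16)],
    [(4, 1), (16, 18), (-16, -17), (20, 30), (-20, -29), (-4, -3)],
    [(4, 2), (-4, -6), (20, 28), (16, 14), (-16, -13), (-20, -25)],
    [(-16, -23), (4, 5), (20, 24), (-16, -22), (16, 12), (4, 4)]]"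

definition progs_6 :: "(int \<times> int \<times> int) list list" where
  "progs_6 =
   [[(0, 1, 1), (-1, -1, -1), (-16, -11, 1), (17, 23, -1)],
    [(-10, -11, 1), (-2, -2, -2), (-8, -10, 2), (20, 23, -1)],
    [(8, 11, -2), (-8, -12, -1), (14, 12, 1), (-14, -11, 2)],
    [(-12, -11, 2), (17, 25, 2), (12, 10, -2), (-17, -24, -2)],
    [(14, 10, -2), (-6, -10, 2), (-2, -1, -2), (-6, -11, 2)]]"

lemma template_6:
  "template 5 6 4 base_6 progs_6 [-1, 0, 0, 0, 0] [-1, 0, 0, 0, 0, 0]
     ([1, 1, 2] @ replicate 11 0 @ [2, 2, 1, 1, 2, 2, 1, 1] @ replicate 12 0 @ [1, 2, 1] @ replicate 7 0)"
  by code_simp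

theorem theorem7:
  fixes n :: nat
  assumes "n \<ge> 3"
  shows "\<exists>A. heffter_array 5 n A \<and>
             (([n = 0] (mod 4) \<or> [n = 3] (mod 4)) \<longrightarrow> integer_heffter_array 5 n A)"
proof -
  \<comment> \<open>\<open>k\<close> counts the blocks of four columns; the remainder leaves
    \<open>r\<close> in 3, ..., 6.\<close>
  define k where "k = (n - 3) div 4"
  have n: "n = 3 + (4 * k + (n - 3) mod 4)" using assms by (simp add: k_def)
  have "(n - 3) mod 4 < 4" by simp
  then consider "n = 3 + 4 * k" | "n = 4 + 4 * k" | "n = 5 + 4 * k" | "n = 6 + 4 * k"
    using n by linarith
  then show ?thesis
  proof cases
    case 1
    then show ?thesis
      using integer_heffter_array_expand[OF template_3, of k]
      by (blast intro: integer_heffter_array_imp_heffter_array)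
  next
    case 2
    then show ?thesis
      using integer_heffter_array_expand[OF template_4, of k]
      by (blast intro: integer_heffter_array_imp_heffter_array)
  next
    case 3
    \<comment> \<open>In this residue class the claim about integer arrays is vacuous.\<close>
    then have "n mod 4 = 1" by presburger
    then show ?thesis
      using heffter_array_expand[OF template_5, of k] 3 by (auto simp: cong_def)
  next
    case 4
    then have "n mod 4 = 2" by presburger
    then show ?thesis
      using heffter_array_expand[OF template_6, of k] 4 by (auto simp: cong_def)
  qed
qed

end
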